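(* Let $d\in\mathbb N$, let $\mathcal{D}_d$ be the class of finite graphs with maximum degree at most $d$, and let $\tau$ be an FO transduction. Then there exist integers $\ell$ and $q$, depending only on $d$ and $\tau$, such that every graph $H\in\tau(\mathcal{D}_d)$ is $(\ell,q)$-near-covered.
   Context: Graphs are finite, simple and undirected. FO logic is first-order logic over relational structures (vertex variables, equality, the relations of the structure, Boolean connectives, vertex quantifiers). A basic FO transduction $\tau_0$ is a triple $(\chi,\nu,\mu)$ of FO formulas with $0$, $1$ and $2$ free variables (with $\mu$ defining a symmetric irreflexive relation); it maps a structure $G$ to the graph with vertex set $\{v\mid G\models\nu(v)\}$ and edge set $\{\{u,v\}\mid G\models\mu(u,v)\}$ restricted to these vertices, and is undefined if $G\not\models\chi$. The $m$-copy operation maps a graph $G$ to $G^m$ with vertex set $V(G)\times\{1,\dots,m\}$, where each $V(G)\times\{i\}$ induces a copy of $G$, there are no edges between distinct copies, and $G^m$ is equipped with a binary relation $\sim$ with $(u,i)\sim(v,j)$ iff $u=v$, and unary relations $Q_i=\{(v,i)\mid v\in V(G)\}$. The $p$-parameter expansion maps $G$ to the set of all structures obtained by adding $p$ arbitrary unary predicates on $V(G)$. An FO transduction is a many-valued map $\tau=\tau_0\circ\gamma\circ\varepsilon$ with $\tau_0$ a basic FO transduction (whose formulas may use $\sim$ and $Q_i$), $\gamma$ an $m$-copy operation and $\varepsilon$ a $p$-parameter expansion, for some $m,p$; for a class $\mathcal{C}$, $\tau(\mathcal{C})=\bigcup_{G\in\mathcal{C}}\tau(G)$. For $v$ in a graph,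 $N(v)$ is its neighbour set; $u,v$ are near-$\ell$-twins if $|N(u)\mathop{\bigtriangleup} N(v)|\le\ell$. A graph $H$ is $(\ell,q)$-near-covered if there exist vertices $v_1,\dots,v_q\in V(H)$ such that every vertex of $H$ is a near-$\ell$-twin of at least one of them. *)

theory Defs
  imports Main
begin

section \<open>Finite simple graphs\<close>

record 'a graph =
  verts :: "'a set"
  edges :: "'a set set"

definition simple_graph :: "'a graph \<Rightarrow> bool" where
  "simple_graph G \<longleftrightarrow> finite (verts G) \<and> (\<forall>e\<in>edges G. e \<subseteq> verts G \<and> card e = 2)"

definition nbhd :: "'a graph \<Rightarrow> 'a \<Rightarrow> 'a set" where
  "nbhd G v = {u. {u, v} \<in> edges G}"

definition bounded_degree_graphs :: "nat \<Rightarrow> 'a graph set" where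
  "bounded_degree_graphs d = {G. simple_graph G \<and> (\<forall>v\<in>verts G. card (nbhd G v) \<le> d)}"

definition near_twins :: "nat \<Rightarrow> 'a graph \<Rightarrow> 'a \<Rightarrow> 'a \<Rightarrow> bool" where
  "near_twins l G u v \<longleftrightarrow> card (sym_diff (nbhd G u) (nbhd G v)) \<le> l"

text \<open>
  The vertices \<open>v\<^sub>1, \<dots>, v\<^sub>q\<close> need not be distinct, so they amount to a set of at most \<open>q\<close>
  vertices. The two formulations differ only for the graph without vertices, which counts as
  near-covered here for every \<open>q\<close>.
\<close>

definition near_covered :: "nat \<Rightarrow> nat \<Rightarrow> 'a graph \<Rightarrow> bool" where
  "near_covered l q H \<longleftrightarrow>
     (\<exists>S. S \<subseteq> verts H \<and> finite S \<and> card S \<le> q \<and> (\<forall>u\<in>verts H. \<exists>v\<in>S. near_twins l H u v))"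


section \<open>First-order logic over relational structures\<close>

datatype 'r fo =
    Eq nat nat
  | Rel 'r "nat list"
  | Neg "'r fo"
  | And "'r fo" "'r fo"
  | Or "'r fo" "'r fo"
  | Exists nat "'r fo"
  | Forall nat "'r fo"

primrec free_vars :: "'r fo \<Rightarrow> nat set" where
  "free_vars (Eq x y) = {x, y}"
| "free_vars (Rel r xs) = set xs"
| "free_vars (Neg \<phi>) = free_vars \<phi>"
| "free_vars (And \<phi> \<psi>) = free_vars \<phi> \<union> free_vars \<psi>"
| "free_vars (Or \<phi> \<psi>) = free_vars \<phi> \<union> free_vars \<psi>"
| "free_vars (Exists x \<phi>) = free_vars \<phi> - {x}"
| "free_vars (Forall x \<phi>) = free_vars \<phi> - {x}"

primrec over_vocab :: "'r set \<Rightarrow> ('r \<Rightarrow> nat) \<Rightarrow> 'r fo \<Rightarrow> bool" where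
  "over_vocab L ar (Eq x y) \<longleftrightarrow> True"
| "over_vocab L ar (Rel r xs) \<longleftrightarrow> r \<in> L \<and> length xs = ar r"
| "over_vocab L ar (Neg \<phi>) \<longleftrightarrow> over_vocab L ar \<phi>"
| "over_vocab L ar (And \<phi> \<psi>) \<longleftrightarrow> over_vocab L ar \<phi> \<and> over_vocab L ar \<psi>"
| "over_vocab L ar (Or \<phi> \<psi>) \<longleftrightarrow> over_vocab L ar \<phi> \<and> over_vocab L ar \<psi>"
| "over_vocab L ar (Exists x \<phi>) \<longleftrightarrow> over_vocab L ar \<phi>"
| "over_vocab L ar (Forall x \<phi>) \<longleftrightarrow> over_vocab L ar \<phi>"

record ('r, 'a) struct =
  univ :: "'a set"
  interp :: "'r \<Rightarrow> 'a list \<Rightarrow> bool"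

primrec sat :: "('r, 'a) struct \<Rightarrow> (nat \<Rightarrow> 'a) \<Rightarrow> 'r fo \<Rightarrow> bool" where
  "sat M s (Eq x y) \<longleftrightarrow> s x = s y"
| "sat M s (Rel r xs) \<longleftrightarrow> interp M r (map s xs)"
| "sat M s (Neg \<phi>) \<longleftrightarrow> \<not> sat M s \<phi>"
| "sat M s (And \<phi> \<psi>) \<longleftrightarrow> sat M s \<phi> \<and> sat M s \<psi>"
| "sat M s (Or \<phi> \<psi>) \<longleftrightarrow> sat M s \<phi> \<or> sat M s \<psi>"
| "sat M s (Exists x \<phi>) \<longleftrightarrow> (\<exists>a\<in>univ M. sat M (s(x := a)) \<phi>)"
| "sat M s (Forall x \<phi>) \<longleftrightarrow> (\<forall>a\<in>univ M. sat M (s(x := a)) \<phi>)"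

text \<open>
  A formula with \<open>k\<close> free variables is one with free variables among \<open>0, \<dots>, k - 1\<close>, evaluated
  at a list of length \<open>k\<close>. The values of \<open>(!) as\<close> beyond the length of \<open>as\<close> are never looked at.
\<close>

definition holds :: "('r, 'a) struct \<Rightarrow> 'r fo \<Rightarrow> 'a list \<Rightarrow> bool" where
  "holds M \<phi> as \<longleftrightarrow> sat M ((!) as) \<phi>"


section \<open>Transductions\<close>

text \<open>
  \<open>Same\<close> is the relation \<open>\<sim>\<close> between copies of one vertex, \<open>Copy i\<close> is the predicate \<open>Q\<^sub>i\<close>,
  and \<open>Param j\<close> is the \<open>j\<close>-th predicate added by the parameter expansion.
\<close>

datatype symb = Adj | Same | Copy nat | Param nat

fun arity :: "symb \<Rightarrow> nat" where
  "arity Adj = 2"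
| "arity Same = 2"
| "arity (Copy i) = 1"
| "arity (Param j) = 1"

definition vocab :: "nat \<Rightarrow> nat \<Rightarrow> symb set" where
  "vocab m p = {Adj, Same} \<union> Copy ` {1..m} \<union> Param ` {1..p}"

definition expanded :: "nat \<Rightarrow> 'a graph \<Rightarrow> (nat \<Rightarrow> 'a set) \<Rightarrow> (symb, 'a) struct" where
  "expanded p G P =
     \<lparr>univ = verts G,
      interp = (\<lambda>r xs. case r of
          Adj \<Rightarrow> (\<exists>u v. xs = [u, v] \<and> {u, v} \<in> edges G)
        | Same \<Rightarrow> False
        | Copy i \<Rightarrow> False
        | Param j \<Rightarrow> j \<in> {1..p} \<and> (\<exists>v. xs = [v] \<and> v \<in> P j))\<rparr>"

definition expansions :: "nat \<Rightarrow> 'a graph \<Rightarrow> (symb, 'a) struct set" where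
  "expansions p G = {expanded p G P | P. \<forall>j\<in>{1..p}. P j \<subseteq> verts G}"

definition copies :: "nat \<Rightarrow> (symb, 'a) struct \<Rightarrow> (symb, 'a \<times> nat) struct" where
  "copies m M =
     \<lparr>univ = univ M \<times> {1..m},
      interp = (\<lambda>r xs. case r of
          Adj \<Rightarrow> (\<exists>u v. \<exists>i\<in>{1..m}. xs = [(u, i), (v, i)] \<and> interp M Adj [u, v])
        | Same \<Rightarrow> (\<exists>v\<in>univ M. \<exists>i\<in>{1..m}. \<exists>j\<in>{1..m}. xs = [(v, i), (v, j)])
        | Copy i \<Rightarrow> i \<in> {1..m} \<and> (\<exists>v\<in>univ M. xs = [(v, i)])
        | Param j \<Rightarrow> (\<exists>v. \<exists>i\<in>{1..m}. xs = [(v, i)] \<and> interp M (Param j) [v]))\<rparr>"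

record basic_transduction =
  dom_fo :: "symb fo"
  vert_fo :: "symb fo"
  edge_fo :: "symb fo"

definition apply_basic :: "basic_transduction \<Rightarrow> (symb, 'a) struct \<Rightarrow> 'a graph option" where
  "apply_basic t M =
     (if holds M (dom_fo t) []
      then let W = {v \<in> univ M. holds M (vert_fo t) [v]}
           in Some \<lparr>verts = W,
                    edges = {{u, v} | u v. u \<in> W \<and> v \<in> W \<and> holds M (edge_fo t) [u, v]}\<rparr>
      else None)"

record transduction =
  basic :: basic_transduction
  num_copies :: nat
  num_params :: nat

text \<open>
  The edge formula has to define a symmetric irreflexive relation on every structure to which the
  basic transduction is applied, that is, on every copy of an expanded finite graph. Satisfaction
  is invariant under isomorphism and every finite graph is isomorphic to one with vertices in
  \<open>nat\<close>, so asking this for graphs over \<open>nat\<close> covers graphs over any vertex type.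
\<close>

definition fo_transduction :: "transduction \<Rightarrow> bool" where
  "fo_transduction \<tau> \<longleftrightarrow>
     (let \<chi> = dom_fo (basic \<tau>); \<nu> = vert_fo (basic \<tau>); \<mu> = edge_fo (basic \<tau>);
          m = num_copies \<tau>; p = num_params \<tau>
      in (\<forall>\<phi>\<in>{\<chi>, \<nu>, \<mu>}. over_vocab (vocab m p) arity \<phi>) \<and>
         free_vars \<chi> = {} \<and> free_vars \<nu> \<subseteq> {0} \<and> free_vars \<mu> \<subseteq> {0, 1} \<and>
         (\<forall>G :: nat graph. simple_graph G \<longrightarrow>
            (\<forall>M \<in> copies m ` expansions p G.
               symp_on (univ M) (\<lambda>u v. holds M \<mu> [u, v]) \<and>
               irreflp_on (univ M) (\<lambda>u v. holds M \<mu> [u, v]))))"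

definition transduce :: "transduction \<Rightarrow> 'a graph \<Rightarrow> ('a \<times> nat) graph set" where
  "transduce \<tau> G =
     {H. \<exists>M \<in> expansions (num_params \<tau>) G.
           apply_basic (basic \<tau>) (copies (num_copies \<tau>) M) = Some H}"

definition transduce_class :: "transduction \<Rightarrow> 'a graph set \<Rightarrow> ('a \<times> nat) graph set" where
  "transduce_class \<tau> C = (\<Union>G\<in>C. transduce \<tau> G)"

end

theory Submission
  imports Defs
begin

text \<open>
  The argument is Hanf's, inside a single finite structure of bounded degree. If the
  \<open>r\<close>-neighbourhoods of two tuples are isomorphic, for \<open>r\<close> large in terms of the quantifier rank,
  then the tuples satisfy the same formulas: an element close to the first tuple is answered by its
  image, and for an element far from it there is an equally typed one far from the second tuple,
  because the isomorphism makes each type occur equally often close to both tuples. Consequently, if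
  \<open>u\<close> and \<open>u'\<close> have isomorphic \<open>r\<close>-neighbourhoods, the edge formula can tell them apart only at
  vertices within distance \<open>2r + 1\<close> of one of them. There are boundedly many such vertices, and
  boundedly many isomorphism types of \<open>r\<close>-neighbourhoods.
\<close>

section \<open>Balls\<close>

primrec ball :: "('a \<times> 'a) set \<Rightarrow> nat \<Rightarrow> 'a set \<Rightarrow> 'a set" where
  "ball E 0 X = X"
| "ball E (Suc n) X = ball E n X \<union> E `` ball E n X"

lemma ball_mono: "X \<subseteq> Y \<Longrightarrow> ball E n X \<subseteq> ball E n Y"
  by (induction n) auto

lemma ball_mono_radius: "i \<le> j \<Longrightarrow> ball E i X \<subseteq> ball E j X"
  by (rule lift_Suc_mono_le[of "\<lambda>n. ball E n X"]) auto

lemma subset_ball: "X \<subseteq> ball E n X"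
  using ball_mono_radius[of 0 n E X] by simp

lemma ball_ball: "ball E i (ball E j X) = ball E (j + i) X"
  by (induction i) auto

lemma ball_Un: "ball E n (X \<union> Y) = ball E n X \<union> ball E n Y"
  by (induction n) auto

lemma ball_subset: "E \<subseteq> U \<times> U \<Longrightarrow> X \<subseteq> U \<Longrightarrow> ball E n X \<subseteq> U"
  by (induction n) auto

lemma ball_sym:
  assumes "sym E" "y \<in> ball E n {x}" "y \<in> X"
  shows "x \<in> ball E n X"
  using assms(2,3)
proof (induction n arbitrary: y X)
  case 0
  then show ?case by simp
next
  case (Suc n)
  show ?case
  proof (cases "y \<in> ball E n {x}")
    case True
    with Suc show ?thesis by auto
  next
    case False
    with Suc.prems obtain z where z: "z \<in> ball E n {x}" "(z, y) \<in> E" by auto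
    with assms(1) Suc.prems have "z \<in> ball E 1 X" by (auto dest: symD)
    with Suc.IH z have "x \<in> ball E n (ball E 1 X)" by blast
    then show ?thesis by (simp only: ball_ball) simp
  qed
qed

text \<open>If \<open>a\<close> and \<open>b\<close> were equal or adjacent, then \<open>b\<close>
  would lie within r + 1 of \<open>X\<close> and \<open>c\<close> within r of \<open>b\<close>,
  hence \<open>c\<close> within 2r + 1 of \<open>X\<close>. So the r-balls around \<open>X\<close>
  and a far point \<open>c\<close> form a disjoint union without edges between them.\<close>

lemma far_apart:
  assumes "sym E" "c \<notin> ball E (2 * r + 1) X" "a \<in> ball E r X" "b \<in> ball E r {c}"
  shows "a \<noteq> b" "(a, b) \<notin> E"
proof -
  have *: "b \<notin> ball E (Suc r) X"
  proof
    assume "b \<in> ball E (Suc r) X"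
    from ball_sym[OF assms(1,4) this] have "c \<in> ball E (2 * r + 1) X"
      by (simp only: ball_ball) (simp add: mult_2)
    with assms(2) show False ..
  qed
  with assms(3) show "a \<noteq> b" "(a, b) \<notin> E" by auto
qed

text \<open>Each step adds at most \<open>D\<close> new elements per old one, so the size grows by a
  factor of at most D + 1. The bound is crude, but it depends only on \<open>D\<close> and
  \<open>n\<close>.\<close>

lemma finite_ball_card_le:
  assumes fin: "\<And>x. finite (E `` {x})" and deg: "\<And>x. card (E `` {x}) \<le> D"
  shows "finite (ball E n {v}) \<and> card (ball E n {v}) \<le> (D + 1) ^ n"
proof (induction n)
  case 0
  then show ?case by simp
next
  case (Suc n)
  let ?B = "ball E n {v}"
  have eq: "E `` ?B = (\<Union>x\<in>?B. E `` {x})" by auto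
  have "card (E `` ?B) \<le> (\<Sum>x\<in>?B. card (E `` {x}))"
    unfolding eq using Suc by (intro card_UN_le) auto
  also have "\<dots> \<le> card ?B * D"
    using sum_bounded_above[of ?B "\<lambda>x. card (E `` {x})" D] deg by simp
  finally have "card (ball E (Suc n) {v}) \<le> card ?B + card ?B * D"
    using card_Un_le[of ?B "E `` ?B"] by simp
  also have "\<dots> = (D + 1) * card ?B" by simp
  also have "\<dots> \<le> (D + 1) * (D + 1) ^ n" using Suc by (intro mult_le_mono2) auto
  finally show ?case using Suc fin by (auto simp: eq)
qed

section \<open>Local equivalence in structures of bounded degree\<close>

text \<open>\<open>E\<close> is any symmetric relation containing the Gaifman graph of \<open>M\<close>.\<close>

locale gaifman_structure =
  fixes M :: "('r, 'a) struct" and L :: "'r set" and ar :: "'r \<Rightarrow> nat" and E :: "('a \<times> 'a) set"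
  assumes finite_univ: "finite (univ M)"
    and E_subset: "E \<subseteq> univ M \<times> univ M"
    and sym_E: "sym E"
    and guarded: "\<lbrakk>r \<in> L; length xs = ar r; interp M r xs; x \<in> set xs; y \<in> set xs; x \<noteq> y\<rbrakk>
      \<Longrightarrow> (x, y) \<in> E"
begin

section \<open>Isomorphisms between induced substructures\<close>

text \<open>Besides the relations in \<open>L\<close>, the map has to respect \<open>E\<close>,
  which may be larger than the Gaifman graph. This makes it compatible with balls, since distances
  are measured in \<open>E\<close>.\<close>

definition piso :: "('a \<Rightarrow> 'a) \<Rightarrow> 'a set \<Rightarrow> 'a set \<Rightarrow> bool" where
  "piso f A B \<longleftrightarrow> bij_betw f A B \<and>
     (\<forall>x\<in>A. \<forall>y\<in>A. (f x, f y) \<in> E \<longleftrightarrow> (x, y) \<in> E) \<and>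
     (\<forall>r\<in>L. \<forall>xs. set xs \<subseteq> A \<and> length xs = ar r \<longrightarrow>
        (interp M r (map f xs) \<longleftrightarrow> interp M r xs))"

lemma pisoI:
  assumes "bij_betw f A B"
    and "\<And>x y. x \<in> A \<Longrightarrow> y \<in> A \<Longrightarrow> (f x, f y) \<in> E \<longleftrightarrow> (x, y) \<in> E"
    and "\<And>r xs. r \<in> L \<Longrightarrow> set xs \<subseteq> A \<Longrightarrow> length xs = ar r \<Longrightarrow>
      interp M r (map f xs) \<longleftrightarrow> interp M r xs"
  shows "piso f A B"
  using assms by (simp add: piso_def)

lemma piso_bij: "piso f A B \<Longrightarrow> bij_betw f A B"
  by (simp add: piso_def)

lemma piso_in: "piso f A B \<Longrightarrow> x \<in> A \<Longrightarrow> f x \<in> B"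
  by (rule bij_betw_apply[OF piso_bij])

lemma piso_edge_iff:
  "piso f A B \<Longrightarrow> x \<in> A \<Longrightarrow> y \<in> A \<Longrightarrow> (f x, f y) \<in> E \<longleftrightarrow> (x, y) \<in> E"
  by (simp add: piso_def)

lemma piso_interp_iff:
  "piso f A B \<Longrightarrow> r \<in> L \<Longrightarrow> set xs \<subseteq> A \<Longrightarrow> length xs = ar r \<Longrightarrow>
    interp M r (map f xs) \<longleftrightarrow> interp M r xs"
  by (simp add: piso_def)

lemma piso_id: "piso id A A"
  by (simp add: piso_def)

lemma piso_inv:
  assumes f: "piso f A B"
  shows "piso (inv_into A f) B A"
proof (rule pisoI)
  let ?g = "inv_into A f"
  show g: "bij_betw ?g B A" using piso_bij[OF f] by (rule bij_betw_inv_into)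
  note gA = bij_betw_apply[OF g]
  have fg: "f (?g y) = y" if "y \<in> B" for y
    using that piso_bij[OF f] by (simp add: bij_betw_inv_into_right)
  show "(?g x, ?g y) \<in> E \<longleftrightarrow> (x, y) \<in> E" if "x \<in> B" "y \<in> B" for x y
    using piso_edge_iff[OF f gA[OF that(1)] gA[OF that(2)]] that by (simp add: fg)
  show "interp M r (map ?g ys) \<longleftrightarrow> interp M r ys"
    if "r \<in> L" "set ys \<subseteq> B" "length ys = ar r" for r ys
  proof -
    have "map f (map ?g ys) = ys" using that(2) fg by (auto intro!: map_idI)
    moreover have "interp M r (map f (map ?g ys)) \<longleftrightarrow> interp M r (map ?g ys)"
      using that gA by (intro piso_interp_iff[OF f]) auto
    ultimately show ?thesis by (simp only:)
  qed
qed

lemma piso_compose: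
  assumes f: "piso f A B" and g: "piso g B C"
  shows "piso (g \<circ> f) A C"
proof (rule pisoI)
  show "bij_betw (g \<circ> f) A C"
    using piso_bij[OF f] piso_bij[OF g] by (rule bij_betw_trans)
  show "((g \<circ> f) x, (g \<circ> f) y) \<in> E \<longleftrightarrow> (x, y) \<in> E" if "x \<in> A" "y \<in> A" for x y
    using that by (simp add: piso_edge_iff[OF f] piso_edge_iff[OF g] piso_in[OF f])
  show "interp M r (map (g \<circ> f) xs) \<longleftrightarrow> interp M r xs"
    if "r \<in> L" "set xs \<subseteq> A" "length xs = ar r" for r xs
  proof -
    have "interp M r (map g (map f xs)) \<longleftrightarrow> interp M r (map f xs)"
      using that piso_in[OF f] by (intro piso_interp_iff[OF g]) auto
    with piso_interp_iff[OF f that] show ?thesis by simp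
  qed
qed

lemma piso_restrict:
  assumes f: "piso f A B" and sub: "A' \<subseteq> A"
  shows "piso f A' (f ` A')"
proof (rule pisoI)
  show "bij_betw f A' (f ` A')"
    using piso_bij[OF f] sub by (rule bij_betw_subset) simp
  show "(f x, f y) \<in> E \<longleftrightarrow> (x, y) \<in> E" if "x \<in> A'" "y \<in> A'" for x y
    using that sub by (intro piso_edge_iff[OF f]) auto
  show "interp M r (map f xs) \<longleftrightarrow> interp M r xs"
    if "r \<in> L" "set xs \<subseteq> A'" "length xs = ar r" for r xs
    using that sub by (intro piso_interp_iff[OF f]) auto
qed

text \<open>No tuple that meets both parts can be in a relation, because \<open>guarded\<close>
  would make two of its elements adjacent; the same holds for its image. All remaining tuples lie in
  one part, where \<open>f\<close> or \<open>g\<close> settles the matter.\<close>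

lemma piso_glue:
  assumes f: "piso f A B" and g: "piso g A' B'"
    and A: "\<And>x y. x \<in> A \<Longrightarrow> y \<in> A' \<Longrightarrow> x \<noteq> y \<and> (x, y) \<notin> E"
    and B: "\<And>x y. x \<in> B \<Longrightarrow> y \<in> B' \<Longrightarrow> x \<noteq> y \<and> (x, y) \<notin> E"
  shows "piso (\<lambda>x. if x \<in> A then f x else g x) (A \<union> A') (B \<union> B')"
proof -
  let ?h = "\<lambda>x. if x \<in> A then f x else g x"
  have hf: "?h x = f x" if "x \<in> A" for x using that by simp
  have hg: "?h x = g x" if "x \<in> A'" for x using that A by auto
  note fB = piso_in[OF f] and gB = piso_in[OF g]
  have A2: "(y, x) \<notin> E" if "x \<in> A" "y \<in> A'" for x y using A[OF that] sym_E by (auto dest: symD)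
  have B2: "(y, x) \<notin> E" if "x \<in> B" "y \<in> B'" for x y using B[OF that] sym_E by (auto dest: symD)
  have "bij_betw ?h A B \<longleftrightarrow> bij_betw f A B" using hf by (rule bij_betw_cong)
  with piso_bij[OF f] have "bij_betw ?h A B" by (rule iffD2[rotated])
  moreover have "bij_betw ?h A' B' \<longleftrightarrow> bij_betw g A' B'" using hg by (rule bij_betw_cong)
  with piso_bij[OF g] have "bij_betw ?h A' B'" by (rule iffD2[rotated])
  moreover have "B \<inter> B' = {}" using B by auto
  ultimately have bij: "bij_betw ?h (A \<union> A') (B \<union> B')" by (rule bij_betw_combine)
  have e: "(?h x, ?h y) \<in> E \<longleftrightarrow> (x, y) \<in> E" if xy: "x \<in> A \<union> A'" "y \<in> A \<union> A'" for x y
  proof -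
    consider "x \<in> A" "y \<in> A" | "x \<in> A'" "y \<in> A'" | "x \<in> A" "y \<in> A'" | "x \<in> A'" "y \<in> A"
      using xy by auto
    then show ?thesis
    proof cases
      case 1
      then show ?thesis using piso_edge_iff[OF f] by simp
    next
      case 2
      then show ?thesis using piso_edge_iff[OF g 2] unfolding hg[OF 2(1)] hg[OF 2(2)] by simp
    next
      case 3
      then show ?thesis using A[OF 3] B[OF fB[OF 3(1)] gB[OF 3(2)]] unfolding hg[OF 3(2)] by simp
    next
      case 4
      then show ?thesis using A2[OF 4(2,1)] B2[OF fB[OF 4(2)] gB[OF 4(1)]] unfolding hg[OF 4(1)] by simp
    qed
  qed
  have i: "interp M r (map ?h xs) \<longleftrightarrow> interp M r xs"
    if r: "r \<in> L" and xs: "set xs \<subseteq> A \<union> A'" and len: "length xs = ar r" for r xs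
  proof -
    consider "set xs \<subseteq> A" | "set xs \<subseteq> A'"
      | x y where "x \<in> set xs" "y \<in> set xs" "x \<in> A" "y \<in> A'"
      using xs by blast
    then show ?thesis
    proof cases
      case 1
      then have "map ?h xs = map f xs" by auto
      with piso_interp_iff[OF f r 1 len] show ?thesis by (simp only:)
    next
      case 2
      have "map ?h xs = map g xs" using 2 hg by (intro map_cong refl) blast
      with piso_interp_iff[OF g r 2 len] show ?thesis by (simp only:)
    next
      case 3
      have "\<not> interp M r xs" using guarded[OF r len _ 3(1,2)] A 3 by blast
      moreover have "\<not> interp M r (map ?h xs)"
      proof
        assume *: "interp M r (map ?h xs)"
        have "f x \<in> set (map ?h xs)" using imageI[OF 3(1), of ?h] 3(3) by simp
        moreover have "g y \<in> set (map ?h xs)"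
          using imageI[OF 3(2), of ?h] by (simp only: hg[OF 3(4)] set_map)
        moreover have "f x \<noteq> g y" "(f x, g y) \<notin> E" using B fB gB 3 by auto
        ultimately show False using guarded[OF r _ *, of "f x" "g y"] len by simp
      qed
      ultimately show ?thesis by blast
    qed
  qed
  from bij e i show ?thesis by (rule pisoI)
qed

lemma piso_ball_image_subset:
  assumes "piso f A B" "ball E j Z \<subseteq> A"
  shows "f ` ball E j Z \<subseteq> ball E j (f ` Z)"
  using assms(2)
proof (induction j)
  case 0
  then show ?case by simp
next
  case (Suc j)
  then have IH: "f ` ball E j Z \<subseteq> ball E j (f ` Z)" by auto
  have "f y \<in> ball E (Suc j) (f ` Z)" if "x \<in> ball E j Z" "(x, y) \<in> E" for x y
  proof -
    from that Suc.prems have "x \<in> A" "y \<in> A" by auto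
    with that(2) have "(f x, f y) \<in> E" by (simp add: piso_edge_iff[OF assms(1)])
    with IH that(1) show ?thesis by auto
  qed
  with IH show ?case by auto
qed

text \<open>An edge leaving the domain of \<open>f\<close> has no image, so a ball is tracked only
  while it stays inside that domain; k + j \<le> R ensures this. One inclusion follows paths along
  \<open>f\<close>, the other follows them along its inverse.\<close>

lemma piso_ball_image:
  assumes f: "piso f (ball E R X) (ball E R Y)" and Y: "Y = f ` X"
    and Z: "Z \<subseteq> ball E k X" and R: "k + j \<le> R"
  shows "f ` ball E j Z = ball E j (f ` Z)"
proof
  have sub: "ball E j Z \<subseteq> ball E R X"
    using ball_mono[OF Z, of E j] ball_mono_radius[OF R, of E X] by (auto simp: ball_ball)
  show "f ` ball E j Z \<subseteq> ball E j (f ` Z)"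
    by (rule piso_ball_image_subset[OF f sub])
  let ?g = "inv_into (ball E R X) f"
  note bij = piso_bij[OF f]
  have "f ` ball E k X \<subseteq> ball E k Y"
    unfolding Y using R by (intro piso_ball_image_subset[OF f] ball_mono_radius) simp
  with Z have "f ` Z \<subseteq> ball E k Y" by auto
  from ball_mono[OF this, of E j] ball_mono_radius[OF R, of E Y]
  have sub2: "ball E j (f ` Z) \<subseteq> ball E R Y" by (auto simp: ball_ball)
  have "?g ` f ` Z = Z"
    using bij Z ball_mono_radius[of k R E X] R
    by (intro inv_into_image_cancel) (auto simp: bij_betw_def)
  with piso_ball_image_subset[OF piso_inv[OF f] sub2]
  have *: "?g ` ball E j (f ` Z) \<subseteq> ball E j Z" by simp
  show "ball E j (f ` Z) \<subseteq> f ` ball E j Z"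
  proof
    fix y assume y: "y \<in> ball E j (f ` Z)"
    with sub2 bij have "f (?g y) = y" by (auto simp: bij_betw_inv_into_right)
    with y * show "y \<in> f ` ball E j Z" by (metis image_eqI subsetD)
  qed
qed

section \<open>Local equivalence of tuples and the back-and-forth step\<close>

definition loc_eq :: "nat \<Rightarrow> nat set \<Rightarrow> (nat \<Rightarrow> 'a) \<Rightarrow> (nat \<Rightarrow> 'a) \<Rightarrow> bool" where
  "loc_eq r V s t \<longleftrightarrow>
     (\<exists>f. piso f (ball E r (s ` V)) (ball E r (t ` V)) \<and> (\<forall>x\<in>V. f (s x) = t x))"

lemma loc_eq_sym:
  assumes "loc_eq r V s t"
  shows "loc_eq r V t s"
proof -
  from assms obtain f where f: "piso f (ball E r (s ` V)) (ball E r (t ` V))"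
    and ft: "\<forall>x\<in>V. f (s x) = t x" by (auto simp: loc_eq_def)
  have "inv_into (ball E r (s ` V)) f (t x) = s x" if "x \<in> V" for x
    using piso_bij[OF f] ft that subset_ball[of "s ` V" E r]
    by (intro inv_into_f_eq) (auto simp: bij_betw_def)
  with piso_inv[OF f] show ?thesis unfolding loc_eq_def by blast
qed

lemma loc_eq_mono:
  assumes "loc_eq r V s t" "r' \<le> r" "V' \<subseteq> V"
  shows "loc_eq r' V' s t"
proof -
  from assms obtain f where f: "piso f (ball E r (s ` V)) (ball E r (t ` V))"
    and ft: "\<forall>x\<in>V. f (s x) = t x" by (auto simp: loc_eq_def)
  have im: "f ` s ` W = t ` W" if "W \<subseteq> V" for W using ft that by force
  have sub: "ball E r' (s ` V') \<subseteq> ball E r (s ` V)"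
    using ball_mono[of "s ` V'" "s ` V" E r'] ball_mono_radius[OF assms(2), of E "s ` V"] assms(3)
    by blast
  have "f ` ball E r' (s ` V') = ball E r' (f ` s ` V')"
    using assms im[of V] by (intro piso_ball_image[OF f, where k = 0]) auto
  with piso_restrict[OF f sub] im[OF assms(3)] ft assms(3) show ?thesis
    unfolding loc_eq_def by (metis subsetD)
qed

definition same_type :: "nat \<Rightarrow> 'a \<Rightarrow> 'a \<Rightarrow> bool" where
  "same_type r x y \<longleftrightarrow> (\<exists>f. piso f (ball E r {x}) (ball E r {y}) \<and> f x = y)"

lemma same_type_refl: "same_type r x x"
  using piso_id unfolding same_type_def by (metis id_apply)

text \<open>Serves to transfer points near one tuple to equally typed points just as near the other
  tuple; k + r \<le> R keeps the whole r-ball around \<open>c\<close> inside the domain of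
  \<open>f\<close>.\<close>

lemma loc_eq_same_type:
  assumes f: "piso f (ball E R (s ` V)) (ball E R (t ` V))" and ft: "\<forall>x\<in>V. f (s x) = t x"
    and c: "c \<in> ball E k (s ` V)" and R: "k + r \<le> R"
  shows "same_type r c (f c)" "f c \<in> ball E k (t ` V)"
proof -
  have t: "t ` V = f ` s ` V" using ft by force
  have 1: "f ` ball E r {c} = ball E r {f c}"
    using piso_ball_image[OF f t _ R, of "{c}"] c by simp
  have "ball E r {c} \<subseteq> ball E R (s ` V)"
    using ball_mono[of "{c}" "ball E k (s ` V)" E r] ball_mono_radius[OF R, of E "s ` V"] c
    by (auto simp: ball_ball)
  from piso_restrict[OF f this] 1 show "same_type r c (f c)"
    unfolding same_type_def by auto
  have "f ` ball E k (s ` V) = ball E k (t ` V)"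
    using piso_ball_image[OF f t, of "s ` V" 0 k] t R by simp
  with c show "f c \<in> ball E k (t ` V)" by auto
qed

lemma same_type_trans: "same_type r x y \<Longrightarrow> same_type r y z \<Longrightarrow> same_type r x z"
  unfolding same_type_def using piso_compose by (metis comp_apply)

text \<open>By \<open>far_apart\<close>, the ball around the new point neither meets nor touches the
  ball around the old tuple, on both sides. Hence the two isomorphisms can be chosen independently
  and glued.\<close>

lemma loc_eq_extend_far:
  assumes st: "loc_eq r V s t" and c: "same_type r c c'" and x: "x \<notin> V"
    and far: "c \<notin> ball E (2 * r + 1) (s ` V)" "c' \<notin> ball E (2 * r + 1) (t ` V)"
  shows "loc_eq r (insert x V) (s(x := c)) (t(x := c'))"
proof -
  from st obtain f where f: "piso f (ball E r (s ` V)) (ball E r (t ` V))"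
    and ft: "\<forall>x\<in>V. f (s x) = t x" by (auto simp: loc_eq_def)
  from c obtain g where g: "piso g (ball E r {c}) (ball E r {c'})" and gc: "g c = c'"
    by (auto simp: same_type_def)
  let ?h = "\<lambda>y. if y \<in> ball E r (s ` V) then f y else g y"
  have im: "(s(x := c)) ` insert x V = s ` V \<union> {c}" "(t(x := c')) ` insert x V = t ` V \<union> {c'}"
    using x by auto
  have "piso ?h (ball E r (s ` V) \<union> ball E r {c}) (ball E r (t ` V) \<union> ball E r {c'})"
    using far_apart[OF sym_E far(1)] far_apart[OF sym_E far(2)] by (intro piso_glue[OF f g]) auto
  moreover have "?h c = c'"
    using far(1) gc ball_mono_radius[of r "2 * r + 1" E "s ` V"] by auto
  moreover have "?h (s y) = t y" if "y \<in> V" for y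
    using ft that subset_ball[of "s ` V" E r] by auto
  ultimately show ?thesis
    unfolding loc_eq_def im ball_Un using x by (intro exI[of _ ?h]) force
qed

text \<open>The radius is 3r + 1 = (2r + 1) + r. A point within 2r + 1 of the tuple has its r-ball
  inside the domain of the isomorphism and is answered by its image; a point beyond 2r + 1 is far
  enough for gluing and is answered by counting.\<close>

lemma loc_eq_extend:
  assumes st: "loc_eq (3 * r + 1) V s t" and x: "x \<notin> V" and c: "c \<in> univ M"
    and V: "s ` V \<subseteq> univ M" "t ` V \<subseteq> univ M"
  shows "\<exists>c'\<in>univ M. loc_eq r (insert x V) (s(x := c)) (t(x := c'))"
proof -
  let ?R = "3 * r + 1" and ?Bs = "ball E (2 * r + 1) (s ` V)" and ?Bt = "ball E (2 * r + 1) (t ` V)"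
  show ?thesis
  proof (cases "c \<in> ?Bs")
    case True
    from st obtain f where f: "piso f (ball E ?R (s ` V)) (ball E ?R (t ` V))"
      and ft: "\<forall>x\<in>V. f (s x) = t x" by (auto simp: loc_eq_def)
    have t: "t ` V = f ` s ` V" using ft by force
    have im: "(s(x := c)) ` insert x V = s ` V \<union> {c}"
      "(t(x := f c)) ` insert x V = f ` (s ` V \<union> {c})"
      using x t by auto
    have Z: "s ` V \<union> {c} \<subseteq> ?Bs" using True subset_ball[of "s ` V" E "2 * r + 1"] by auto
    have R: "2 * r + 1 + r \<le> ?R" by simp
    have "ball E r (s ` V \<union> {c}) \<subseteq> ball E ?R (s ` V)"
      using ball_mono[OF Z, of E r] ball_mono_radius[OF R, of E "s ` V"]
      by (auto simp only: ball_ball)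
    from piso_restrict[OF f this] piso_ball_image[OF f t Z R]
    have "loc_eq r (insert x V) (s(x := c)) (t(x := f c))"
      unfolding loc_eq_def im using ft x by (intro exI[of _ f]) auto
    moreover have "f c \<in> univ M"
      using loc_eq_same_type(2)[OF f ft True R] ball_subset[OF E_subset V(2)] by blast
    ultimately show ?thesis by blast
  next
    case False
    \<comment> \<open>The isomorphism is taken from \<open>t\<close> back to \<open>s\<close>: it
      injects the points of the type of \<open>c\<close> near \<open>t\<close> into those near
      \<open>s\<close>. As \<open>c\<close> has that type and is not near \<open>s\<close>, the
      points near \<open>t\<close> cannot exhaust the type in the finite universe, and any other one
      serves as \<open>c'\<close>.\<close>
    from loc_eq_sym[OF st] obtain f where f: "piso f (ball E ?R (t ` V)) (ball E ?R (s ` V))"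
      and ft: "\<forall>x\<in>V. f (t x) = s x" by (auto simp: loc_eq_def)
    have R: "2 * r + 1 + r \<le> ?R" by simp
    define T where "T = {y \<in> univ M. same_type r c y}"
    have fin: "finite T" using finite_univ by (simp add: T_def)
    have "c \<in> T" using c same_type_refl by (simp add: T_def)
    have "f y \<in> T \<inter> ?Bs" if "y \<in> T \<inter> ?Bt" for y
      using that loc_eq_same_type[OF f ft _ R, of y] ball_subset[OF E_subset V(1)]
      unfolding T_def by (blast intro: same_type_trans)
    moreover have "inj_on f (T \<inter> ?Bt)"
      using ball_mono_radius[of "2 * r + 1" ?R E "t ` V"]
      by (intro inj_on_subset[OF bij_betw_imp_inj_on[OF piso_bij[OF f]]]) auto
    ultimately have "card (T \<inter> ?Bt) \<le> card (T \<inter> ?Bs)"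
      using fin by (intro card_inj_on_le[of f]) auto
    also have "\<dots> < card T" using fin \<open>c \<in> T\<close> False by (intro psubset_card_mono) auto
    finally have "\<not> T \<subseteq> ?Bt" by (auto simp: Int_absorb2)
    then obtain c' where "c' \<in> univ M" "same_type r c c'" "c' \<notin> ?Bt" by (auto simp: T_def)
    moreover have "loc_eq r V s t" using st by (rule loc_eq_mono) auto
    ultimately show ?thesis using loc_eq_extend_far x False by blast
  qed
qed

end

section \<open>Local equivalence preserves satisfaction\<close>

text \<open>The recursion at quantifiers is the loss of radius in \<open>loc_eq_extend\<close>:
  agreement up to 3r + 1 before choosing a point leaves agreement up to r afterwards.\<close>

primrec radius :: "'r fo \<Rightarrow> nat" where
  "radius (Eq x y) = 0"
| "radius (Rel r xs) = 0"
| "radius (Neg \<phi>) = radius \<phi>"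
| "radius (And \<phi> \<psi>) = max (radius \<phi>) (radius \<psi>)"
| "radius (Or \<phi> \<psi>) = max (radius \<phi>) (radius \<psi>)"
| "radius (Exists x \<phi>) = 3 * radius \<phi> + 1"
| "radius (Forall x \<phi>) = 3 * radius \<phi> + 1"

context gaifman_structure
begin

text \<open>Half of a back-and-forth round; the other half is this lemma with \<open>s\<close> and
  \<open>t\<close> exchanged. The old value of \<open>x\<close> is overwritten, so \<open>x\<close>
  is dropped from the set before the extension.\<close>

lemma sat_extend:
  assumes sat: "\<And>s t. loc_eq r V s t \<Longrightarrow> s ` V \<subseteq> univ M \<Longrightarrow> t ` V \<subseteq> univ M \<Longrightarrow>
      sat M s \<phi> \<longleftrightarrow> sat M t \<phi>"
    and st: "loc_eq (3 * r + 1) (V - {x}) s t"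
    and V: "s ` (V - {x}) \<subseteq> univ M" "t ` (V - {x}) \<subseteq> univ M" and c: "c \<in> univ M"
  shows "\<exists>c'\<in>univ M. sat M (s(x := c)) \<phi> \<longleftrightarrow> sat M (t(x := c')) \<phi>"
proof -
  obtain c' where c': "c' \<in> univ M"
    and *: "loc_eq r (insert x (V - {x})) (s(x := c)) (t(x := c'))"
    using loc_eq_extend[OF st _ c V, of x] by blast
  have "sat M (s(x := c)) \<phi> \<longleftrightarrow> sat M (t(x := c')) \<phi>"
    using c c' V by (intro sat loc_eq_mono[OF *]) auto
  with c' show ?thesis by blast
qed

theorem loc_eq_sat:
  assumes "over_vocab L ar \<phi>" "loc_eq (radius \<phi>) (free_vars \<phi>) s t"
    "s ` free_vars \<phi> \<subseteq> univ M" "t ` free_vars \<phi> \<subseteq> univ M"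
  shows "sat M s \<phi> \<longleftrightarrow> sat M t \<phi>"
  using assms
proof (induction \<phi> arbitrary: s t)
  case (Eq x y)
  then obtain f where "piso f {s x, s y} {t x, t y}" and ft: "f (s x) = t x" "f (s y) = t y"
    by (auto simp: loc_eq_def)
  then have "inj_on f {s x, s y}" by (blast dest: piso_bij bij_betw_imp_inj_on)
  with ft show ?case by auto
next
  case (Rel r xs)
  then obtain f where f: "piso f (s ` set xs) (t ` set xs)" and ft: "\<forall>x\<in>set xs. f (s x) = t x"
    by (auto simp: loc_eq_def)
  from ft have eq: "map t xs = map f (map s xs)" by simp
  have "interp M r (map f (map s xs)) \<longleftrightarrow> interp M r (map s xs)"
    using Rel.prems(1) by (intro piso_interp_iff[OF f]) auto
  then show ?case unfolding sat.simps eq by (rule sym)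
next
  case (Neg \<phi>)
  then show ?case by simp
next
  case (And \<phi> \<psi>)
  have "sat M s \<phi> \<longleftrightarrow> sat M t \<phi>"
    using And.prems by (intro And.IH(1) loc_eq_mono[OF And.prems(2)]) auto
  moreover have "sat M s \<psi> \<longleftrightarrow> sat M t \<psi>"
    using And.prems by (intro And.IH(2) loc_eq_mono[OF And.prems(2)]) auto
  ultimately show ?case by simp
next
  case (Or \<phi> \<psi>)
  have "sat M s \<phi> \<longleftrightarrow> sat M t \<phi>"
    using Or.prems by (intro Or.IH(1) loc_eq_mono[OF Or.prems(2)]) auto
  moreover have "sat M s \<psi> \<longleftrightarrow> sat M t \<psi>"
    using Or.prems by (intro Or.IH(2) loc_eq_mono[OF Or.prems(2)]) auto
  ultimately show ?case by simp
next
  case (Exists x \<phi>)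
  have st: "loc_eq (3 * radius \<phi> + 1) (free_vars \<phi> - {x}) s t"
    and V: "s ` (free_vars \<phi> - {x}) \<subseteq> univ M" "t ` (free_vars \<phi> - {x}) \<subseteq> univ M"
    and \<phi>: "over_vocab L ar \<phi>"
    using Exists.prems by simp_all
  from sat_extend[OF Exists.IH[OF \<phi>] st V] sat_extend[OF Exists.IH[OF \<phi>] loc_eq_sym[OF st] V(2,1)]
  show ?case unfolding sat.simps by blast
next
  case (Forall x \<phi>)
  have st: "loc_eq (3 * radius \<phi> + 1) (free_vars \<phi> - {x}) s t"
    and V: "s ` (free_vars \<phi> - {x}) \<subseteq> univ M" "t ` (free_vars \<phi> - {x}) \<subseteq> univ M"
    and \<phi>: "over_vocab L ar \<phi>"
    using Forall.prems by simp_all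
  from sat_extend[OF Forall.IH[OF \<phi>] st V] sat_extend[OF Forall.IH[OF \<phi>] loc_eq_sym[OF st] V(2,1)]
  show ?case unfolding sat.simps by blast
qed

text \<open>Since \<open>v\<close> is far from both \<open>u\<close> and \<open>u'\<close>, the
  isomorphism of their balls can be glued with the identity on the ball around \<open>v\<close>, so
  the pairs are locally equivalent. Both argument orders are compared because an unordered edge
  arises from either.\<close>

lemma same_type_holds:
  assumes \<phi>: "over_vocab L ar \<phi>" "free_vars \<phi> \<subseteq> {0, 1}"
    and U: "u \<in> univ M" "u' \<in> univ M" "v \<in> univ M"
    and u: "same_type (radius \<phi>) u u'"
    and v: "v \<notin> ball E (2 * radius \<phi> + 1) {u, u'}"
  shows "holds M \<phi> [u, v] \<longleftrightarrow> holds M \<phi> [u', v]" "holds M \<phi> [v, u] \<longleftrightarrow> holds M \<phi> [v, u']"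
proof -
  let ?r = "radius \<phi>"
  have far: "v \<notin> ball E (2 * ?r + 1) {u}" "v \<notin> ball E (2 * ?r + 1) {u'}"
    using v ball_mono[of "{u}" "{u, u'}" E "2 * ?r + 1"] ball_mono[of "{u'}" "{u, u'}" E "2 * ?r + 1"]
    by blast+
  have base: "loc_eq ?r {i} ((!) as) ((!) bs)" if "as ! i = u" "bs ! i = u'" for i as bs
    using u that by (auto simp: loc_eq_def same_type_def)
  have univ: "(!) [a, b] ` free_vars \<phi> \<subseteq> univ M" if "a \<in> univ M" "b \<in> univ M" for a b
    using \<phi>(2) that by auto
  \<comment> \<open>Overwriting an entry of a list by itself changes nothing. This puts the
    valuations into the updated form that \<open>loc_eq_extend_far\<close> produces.\<close>
  have upd: "((!) [a, b])(1 := b) = (!) [a, b]" "((!) [b, a])(0 := b) = (!) [b, a]" for a b :: 'a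
    by (simp_all add: fun_eq_iff)
  have "loc_eq ?r (insert 1 {0}) (((!) [u, v])(1 := v)) (((!) [u', v])(1 := v))"
    using far by (intro loc_eq_extend_far base same_type_refl) auto
  then have "loc_eq ?r (free_vars \<phi>) ((!) [u, v]) ((!) [u', v])"
    unfolding upd by (rule loc_eq_mono) (use \<phi>(2) in auto)
  from loc_eq_sat[OF \<phi>(1) this univ univ] U show "holds M \<phi> [u, v] \<longleftrightarrow> holds M \<phi> [u', v]"
    by (simp add: holds_def)
  have "loc_eq ?r (insert 0 {1}) (((!) [v, u])(0 := v)) (((!) [v, u'])(0 := v))"
    using far by (intro loc_eq_extend_far base same_type_refl) auto
  then have "loc_eq ?r (free_vars \<phi>) ((!) [v, u]) ((!) [v, u'])"
    unfolding upd by (rule loc_eq_mono) (use \<phi>(2) in auto)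
  from loc_eq_sat[OF \<phi>(1) this univ univ] U show "holds M \<phi> [v, u] \<longleftrightarrow> holds M \<phi> [v, u']"
    by (simp add: holds_def)
qed

end

section \<open>Counting isomorphism types\<close>

type_synonym 'r code = "nat \<times> nat set \<times> (nat \<times> nat) set \<times> ('r \<times> nat list) set"

text \<open>A finite supply containing every pointed structure with elements numbered below
  \<open>K\<close>: distinguished element, universe, edges and relations. Its size depends only on
  the vocabulary and \<open>K\<close>, not on the structure at hand.\<close>

definition codes :: "'r set \<Rightarrow> ('r \<Rightarrow> nat) \<Rightarrow> nat \<Rightarrow> 'r code set" where
  "codes L ar K = {..<K} \<times> Pow {..<K} \<times> Pow ({..<K} \<times> {..<K}) \<times>
     Pow (SIGMA r:L. {ns. set ns \<subseteq> {..<K} \<and> length ns = ar r})"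

lemma finite_codes: "finite L \<Longrightarrow> finite (codes L ar K)"
  by (auto simp: codes_def intro!: finite_cartesian_product finite_SigmaI finite_lists_length_eq)

context gaifman_structure
begin

text \<open>
  \<open>code g A v\<close> is the substructure induced on \<open>A\<close> with distinguished element \<open>v\<close>, transported to
  the natural numbers along \<open>g\<close>.
\<close>

definition code_edges :: "('a \<Rightarrow> nat) \<Rightarrow> 'a set \<Rightarrow> (nat \<times> nat) set" where
  "code_edges g A = {(g x, g y) | x y. x \<in> A \<and> y \<in> A \<and> (x, y) \<in> E}"

definition code_rels :: "('a \<Rightarrow> nat) \<Rightarrow> 'a set \<Rightarrow> ('r \<times> nat list) set" where
  "code_rels g A = {(r, map g xs) | r xs. r \<in> L \<and> set xs \<subseteq> A \<and> length xs = ar r \<and> interp M r xs}"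

definition code :: "('a \<Rightarrow> nat) \<Rightarrow> 'a set \<Rightarrow> 'a \<Rightarrow> 'r code" where
  "code g A v = (g v, g ` A, code_edges g A, code_rels g A)"

lemma code_edges_iff:
  "inj_on g A \<Longrightarrow> x \<in> A \<Longrightarrow> y \<in> A \<Longrightarrow> (g x, g y) \<in> code_edges g A \<longleftrightarrow> (x, y) \<in> E"
  by (auto simp: code_edges_def inj_on_def)

lemma code_rels_iff:
  assumes "inj_on g A" "r \<in> L" "set xs \<subseteq> A" "length xs = ar r"
  shows "(r, map g xs) \<in> code_rels g A \<longleftrightarrow> interp M r xs"
proof -
  have "xs = ys" if "map g xs = map g ys" "set ys \<subseteq> A" for ys
    using that assms(1,3) by (meson Un_least inj_on_map_eq_map inj_on_subset)
  with assms show ?thesis unfolding code_rels_def by blast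
qed

text \<open>Both substructures are transported to the same structure on numbers, so following
  \<open>g\<close> and then the inverse of \<open>h\<close> is an isomorphism.\<close>

lemma code_eq_piso:
  assumes g: "inj_on g A" and h: "inj_on h B" "w \<in> B" and eq: "code g A v = code h B w"
  shows "\<exists>f. piso f A B \<and> f v = w"
proof -
  define f where "f = inv_into B h \<circ> g"
  from eq have vw: "g v = h w" and AB: "g ` A = h ` B"
    and edges: "code_edges g A = code_edges h B" and rels: "code_rels g A = code_rels h B"
    by (simp_all add: code_def)
  have hf: "h (f x) = g x" if "x \<in> A" for x
    using that AB unfolding f_def comp_def by (metis f_inv_into_f imageI)
  have "bij_betw g A (h ` B)" using g AB by (auto simp: bij_betw_def)
  moreover have "bij_betw (inv_into B h) (h ` B) B"
    using h(1) by (intro bij_betw_inv_into inj_on_imp_bij_betw)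
  ultimately have bij: "bij_betw f A B" unfolding f_def by (rule bij_betw_trans)
  have fB: "f x \<in> B" if "x \<in> A" for x using bij that by (auto simp: bij_betw_def)
  have "(f x, f y) \<in> E \<longleftrightarrow> (x, y) \<in> E" if "x \<in> A" "y \<in> A" for x y
    using code_edges_iff[OF g that] code_edges_iff[OF h(1) fB[OF that(1)] fB[OF that(2)]]
    by (simp add: edges hf that)
  moreover have "interp M r (map f xs) \<longleftrightarrow> interp M r xs"
    if "r \<in> L" "set xs \<subseteq> A" "length xs = ar r" for r xs
  proof -
    have hfg: "map h (map f xs) = map g xs" using that hf by auto
    have "(r, map h (map f xs)) \<in> code_rels h B \<longleftrightarrow> interp M r (map f xs)"
      using that fB by (intro code_rels_iff[OF h(1)]) auto
    with code_rels_iff[OF g that] show ?thesis unfolding hfg rels by simp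
  qed
  ultimately have "piso f A B" using bij by (intro pisoI)
  moreover have "f v = w"
    using vw h by (simp add: f_def)
  ultimately show ?thesis by blast
qed

lemma bounded_same_type_classes:
  assumes deg: "\<And>x. card (E `` {x}) \<le> D" and L: "finite L"
  shows "\<exists>S\<subseteq>W. finite S \<and> card S \<le> card (codes L ar ((D + 1) ^ r)) \<and>
    (\<forall>u\<in>W. \<exists>v\<in>S. same_type r u v)"
proof -
  let ?K = "(D + 1) ^ r"
  have "finite (E `` {x})" for x
    using finite_univ E_subset by (auto intro: finite_subset[of _ "univ M"])
  from finite_ball_card_le[OF this deg]
  have ball: "finite (ball E r {v})" "card (ball E r {v}) \<le> ?K" for v by auto
  have "\<exists>g :: 'a \<Rightarrow> nat. inj_on g (ball E r {v}) \<and> g ` ball E r {v} \<subseteq> {..<?K}" for v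
    using card_le_inj[OF ball(1), of "{..<?K}" v] ball(2)[of v] by auto
  then obtain g :: "'a \<Rightarrow> 'a \<Rightarrow> nat" where inj: "\<And>v. inj_on (g v) (ball E r {v})"
    and img: "\<And>v. g v ` ball E r {v} \<subseteq> {..<?K}" by metis
  have self: "v \<in> ball E r {v}" for v using subset_ball[of "{v}"] by auto
  \<comment> \<open>The numberings \<open>g v\<close> are arbitrary, so isomorphic balls may receive
    different codes. Only the converse matters: equal codes force the same type, so one
    representative for each attained code suffices.\<close>
  define F where "F v = code (g v) (ball E r {v}) v" for v
  have F: "F v \<in> codes L ar ?K" for v
  proof -
    have lt: "g v x < ?K" if "x \<in> ball E r {v}" for x using img that by blast
    show ?thesis using lt self unfolding F_def code_def codes_def
      by (auto simp: code_edges_def code_rels_def subset_iff)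
  qed
  obtain S where S: "S \<subseteq> W" "inj_on F S" "F ` W = F ` S"
    using subset_image_inj[of "F ` W" F W] by auto
  have fin: "finite (F ` S)" "card (F ` S) \<le> card (codes L ar ?K)"
    using F finite_codes[OF L] by (auto intro: finite_subset card_mono)
  have "\<exists>v\<in>S. same_type r u v" if "u \<in> W" for u
  proof -
    from that S(3) obtain v where "v \<in> S" "F u = F v" by blast
    with code_eq_piso[OF inj inj self] show ?thesis
      unfolding F_def same_type_def by blast
  qed
  with S fin show ?thesis by (metis card_image finite_image_iff)
qed

lemma near_covered_definable_graph:
  assumes deg: "\<And>x. card (E `` {x}) \<le> D" and L: "finite L"
    and \<phi>: "over_vocab L ar \<phi>" "free_vars \<phi> \<subseteq> {0, 1}" and W: "W \<subseteq> univ M"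
  shows "near_covered (2 * (D + 1) ^ (2 * radius \<phi> + 1)) (card (codes L ar ((D + 1) ^ radius \<phi>)))
    \<lparr>verts = W, edges = {{u, v} | u v. u \<in> W \<and> v \<in> W \<and> holds M \<phi> [u, v]}\<rparr>"
    (is "near_covered ?l ?q ?H")
proof -
  let ?R = "2 * radius \<phi> + 1"
  have "finite (E `` {x})" for x
    using finite_univ E_subset by (auto intro: finite_subset[of _ "univ M"])
  from finite_ball_card_le[OF this deg]
  have ball: "finite (ball E ?R {v})" "card (ball E ?R {v}) \<le> (D + 1) ^ ?R" for v by blast+
  have nb: "nbhd ?H u = {w \<in> W. holds M \<phi> [u, w] \<or> holds M \<phi> [w, u]}" if "u \<in> W" for u
    using that by (auto simp: nbhd_def doubleton_eq_iff)
  have "near_twins ?l ?H u u'" if uu: "u \<in> W" "u' \<in> W" "same_type (radius \<phi>) u u'" for u u'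
  proof -
    \<comment> \<open>A vertex outside the two balls is far from both \<open>u\<close> and
      \<open>u'\<close>, so \<open>same_type_holds\<close> gives it the same adjacency to both. The
      factor 2 in the bound accounts for the two balls.\<close>
    have "sym_diff (nbhd ?H u) (nbhd ?H u') \<subseteq> ball E ?R {u, u'}"
      using same_type_holds[OF \<phi> _ _ _ uu(3)] uu W unfolding nb[OF uu(1)] nb[OF uu(2)] by blast
    also have "\<dots> = ball E ?R {u} \<union> ball E ?R {u'}"
      using ball_Un[of E ?R "{u}" "{u'}"] by (simp add: insert_commute)
    finally have "card (sym_diff (nbhd ?H u) (nbhd ?H u')) \<le> card (ball E ?R {u} \<union> ball E ?R {u'})"
      using ball by (intro card_mono) auto
    also have "\<dots> \<le> card (ball E ?R {u}) + card (ball E ?R {u'})" by (rule card_Un_le)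
    also have "\<dots> \<le> ?l" using ball(2)[of u] ball(2)[of u'] by simp
    finally show ?thesis unfolding near_twins_def .
  qed
  moreover obtain S where "S \<subseteq> W" "finite S" "card S \<le> ?q"
    "\<forall>u\<in>W. \<exists>v\<in>S. same_type (radius \<phi>) u v"
    using bounded_same_type_classes[OF deg L] by metis
  ultimately show ?thesis unfolding near_covered_def
    by (intro exI[of _ S]) (simp, blast)
qed

end

section \<open>Transductions of bounded-degree graphs\<close>

text \<open>A relation containing the Gaifman graph of the copied structure. It also joins different
  copies of adjacent vertices, which leaves a degree bound linear in the number of copies.\<close>

definition copies_adj :: "nat \<Rightarrow> 'a graph \<Rightarrow> (('a \<times> nat) \<times> ('a \<times> nat)) set" where
  "copies_adj m G = {((u, i), (v, j)) | u v i j.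
     u \<in> verts G \<and> v \<in> verts G \<and> i \<in> {1..m} \<and> j \<in> {1..m} \<and> (u = v \<or> {u, v} \<in> edges G)}"

text \<open>Only \<open>Adj\<close> and \<open>Same\<close> can relate two distinct elements; the
  unary copy and parameter predicates add nothing to the Gaifman graph, whatever the parameters
  are.\<close>

lemma gaifman_structure_copies:
  assumes "simple_graph G"
  shows "gaifman_structure (copies m (expanded p G P)) (vocab m p) arity (copies_adj m G)"
proof
  show "finite (univ (copies m (expanded p G P)))"
    using assms by (auto simp: copies_def expanded_def simple_graph_def)
  show "copies_adj m G \<subseteq> univ (copies m (expanded p G P)) \<times> univ (copies m (expanded p G P))"
    by (auto simp: copies_adj_def copies_def expanded_def)
  show "sym (copies_adj m G)"
    by (auto simp: copies_adj_def sym_def insert_commute)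
  have verts: "u \<in> verts G" "v \<in> verts G" if "{u, v} \<in> edges G" for u v
    using assms that by (auto simp: simple_graph_def)
  show "(x, y) \<in> copies_adj m G"
    if "interp (copies m (expanded p G P)) r xs" "x \<in> set xs" "y \<in> set xs" "x \<noteq> y" for r xs x y
    using that
    by (cases r; auto simp: copies_def expanded_def copies_adj_def insert_commute; blast dest: verts)
qed

lemma card_copies_adj_le:
  assumes "G \<in> bounded_degree_graphs d"
  shows "card (copies_adj m G `` {x}) \<le> (d + 1) * m"
proof (cases "fst x \<in> verts G")
  case True
  from assms have G: "simple_graph G" and deg: "card (nbhd G (fst x)) \<le> d"
    using True by (auto simp: bounded_degree_graphs_def)
  have "nbhd G (fst x) \<subseteq> verts G" using G by (auto simp: nbhd_def simple_graph_def)
  then have fin: "finite (nbhd G (fst x))" using G by (auto simp: simple_graph_def intro: finite_subset)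
  \<comment> \<open>The first coordinate of a neighbour is \<open>fst x\<close> itself or one of its
    at most \<open>d\<close> neighbours in \<open>G\<close>, and the second is one of
    \<open>m\<close> indices; hence (d + 1) * m.\<close>
  have "copies_adj m G `` {x} \<subseteq> insert (fst x) (nbhd G (fst x)) \<times> {1..m}"
    by (auto simp: copies_adj_def nbhd_def insert_commute)
  then have "card (copies_adj m G `` {x}) \<le> card (insert (fst x) (nbhd G (fst x)) \<times> {1..m})"
    using fin by (intro card_mono) auto
  also have "\<dots> = card (insert (fst x) (nbhd G (fst x))) * m" by (simp add: card_cartesian_product)
  also have "\<dots> \<le> (d + 1) * m"
    using fin deg by (intro mult_le_mono1) (simp add: card_insert_if)
  finally show ?thesis .
next
  case False
  then have "copies_adj m G `` {x} = {}" by (auto simp: copies_adj_def)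
  then show ?thesis by simp
qed

theorem theorem16:
  fixes d :: nat and \<tau> :: transduction
  assumes "fo_transduction \<tau>"
  shows "\<exists>l q :: nat. \<forall>H \<in> transduce_class \<tau> (bounded_degree_graphs d :: 'a graph set).
           near_covered l q H"
proof -
  define m p \<mu> where "m = num_copies \<tau>" and "p = num_params \<tau>" and "\<mu> = edge_fo (basic \<tau>)"
  from assms have \<mu>: "over_vocab (vocab m p) arity \<mu>" "free_vars \<mu> \<subseteq> {0, 1}"
    unfolding fo_transduction_def Let_def m_def p_def \<mu>_def by auto
  have fin: "finite (vocab m p)" by (simp add: vocab_def)
  define D where "D = (d + 1) * m"
  have "near_covered (2 * (D + 1) ^ (2 * radius \<mu> + 1))
      (card (codes (vocab m p) arity ((D + 1) ^ radius \<mu>))) H"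
    if "H \<in> transduce_class \<tau> (bounded_degree_graphs d :: 'a graph set)" for H
  proof -
    from that obtain G P where G: "G \<in> bounded_degree_graphs d"
      and H: "apply_basic (basic \<tau>) (copies m (expanded p G P)) = Some H"
      by (auto simp: transduce_class_def transduce_def expansions_def m_def p_def)
    let ?M = "copies m (expanded p G P)"
    interpret gaifman_structure ?M "vocab m p" arity "copies_adj m G"
      using G by (intro gaifman_structure_copies) (simp add: bounded_degree_graphs_def)
    \<comment> \<open>Distances and types are taken in the whole copied structure \<open>?M\<close>;
      the vertex formula only selects the subset \<open>W\<close> on which neighbourhoods are
      compared.\<close>
    define W where "W = {v \<in> univ ?M. holds ?M (vert_fo (basic \<tau>)) [v]}"
    have "H = \<lparr>verts = W, edges = {{u, v} | u v. u \<in> W \<and> v \<in> W \<and> holds ?M \<mu> [u, v]}\<rparr>"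
      using H unfolding apply_basic_def Let_def W_def \<mu>_def by (simp split: if_splits)
    moreover have "W \<subseteq> univ ?M" by (auto simp: W_def)
    ultimately show ?thesis
      using near_covered_definable_graph[OF card_copies_adj_le[OF G] fin \<mu>] by (simp add: D_def)
  qed
  then show ?thesis by blast
qed

end
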